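(* Let $M < 3$ be a real number, let $d > 0$ be an integer, and let $G$ be a finite simple graph with $\mathrm{mad}(G) < M$. If $d > \frac{2}{3-M} - 2$, then $V(G)$ can be partitioned into sets $A$ and $B$ such that $A$ is an independent set of $G$ and $G[B]$ is a forest each of whose connected components has at most $d+1$ vertices.
   Context: $\mathrm{mad}(G) := \max_{H \subseteq G,\, V(H)\neq\emptyset} \frac{2|E(H)|}{|V(H)|}$ (maximum average degree over nonempty subgraphs). *)

theory Defs
  imports Complex_Main
begin

definition simple_graph :: "'a set \<Rightarrow> 'a set set \<Rightarrow> bool" where
  "simple_graph V E \<longleftrightarrow> finite V \<and> (\<forall>e\<in>E. e \<subseteq> V \<and> card e = 2)"

definition subgraph :: "'a set \<Rightarrow> 'a set set \<Rightarrow> 'a set \<Rightarrow> 'a set set \<Rightarrow> bool" where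
  "subgraph V' E' V E \<longleftrightarrow> V' \<subseteq> V \<and> E' \<subseteq> E \<and> (\<forall>e\<in>E'. e \<subseteq> V')"

definition mad :: "'a set \<Rightarrow> 'a set set \<Rightarrow> real" where
  "mad V E = Max {2 * real (card E') / real (card V') | V' E'. subgraph V' E' V E \<and> V' \<noteq> {}}"

definition independent_set :: "'a set set \<Rightarrow> 'a set \<Rightarrow> bool" where
  "independent_set E A \<longleftrightarrow> (\<forall>x\<in>A. \<forall>y\<in>A. {x, y} \<notin> E)"

definition induced_edges :: "'a set set \<Rightarrow> 'a set \<Rightarrow> 'a set set" where
  "induced_edges E B = {e \<in> E. e \<subseteq> B}"

definition adj :: "'a set set \<Rightarrow> 'a \<Rightarrow> 'a \<Rightarrow> bool" where
  "adj E x y \<longleftrightarrow> {x, y} \<in> E"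

definition is_cycle :: "'a set \<Rightarrow> 'a set set \<Rightarrow> 'a list \<Rightarrow> bool" where
  "is_cycle V E c \<longleftrightarrow> length c \<ge> 3 \<and> distinct c \<and> set c \<subseteq> V \<and>
     (\<forall>i < length c - 1. adj E (c ! i) (c ! Suc i)) \<and> adj E (last c) (hd c)"

definition forest :: "'a set \<Rightarrow> 'a set set \<Rightarrow> bool" where
  "forest V E \<longleftrightarrow> (\<nexists>c. is_cycle V E c)"

definition component :: "'a set \<Rightarrow> 'a set set \<Rightarrow> 'a \<Rightarrow> 'a set" where
  "component V E x = {y. (\<lambda>u v. u \<in> V \<and> v \<in> V \<and> adj E u v)\<^sup>*\<^sup>* x y}"

end

theory Submission
  imports Defs
begin

text \<open>
  Deleting a suitable independent set \<open>I\<close> lowers the maximum average degree by \<open>1\<close>, up to an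
  arbitrarily small error. The remaining graph then has maximum average degree below
  \<open>2 - 2 / (d + 2)\<close>, which excludes cycles as well as trees on \<open>d + 2\<close> or more vertices.

  To find \<open>I\<close>, split \<open>2 N\<close> tokens of every edge between its two ends so as to minimise
  \<open>K (\<Sum> load\<^sup>2) + (\<Sum> share\<^sup>2)\<close>, where the load of a vertex is the sum of its shares and \<open>K\<close> is large
  but much smaller than \<open>N\<close>. The first term keeps all loads below about \<open>N mad(G)\<close>. The second one
  ensures that if the share of \<open>v\<close> in the edge \<open>vw\<close> is less than \<open>N - K\<close>, then \<open>v\<close> has a larger load
  than \<open>w\<close>. Choosing \<open>I\<close> greedily by decreasing load, every vertex outside \<open>I\<close> has a neighbour in
  \<open>I\<close> of at least its own load, hence loses at least \<open>N - K\<close> tokens when \<open>I\<close> is deleted. The loads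
  that remain bound the number of edges of every subgraph avoiding \<open>I\<close>.
\<close>

section \<open>Simple graphs and sums over modified functions\<close>

lemma simple_graph_edgeD:
  assumes "simple_graph V E" "{u, w} \<in> E"
  shows "u \<in> V" "w \<in> V" "u \<noteq> w"
  using assms unfolding simple_graph_def by (auto dest!: bspec[of _ _ "{u, w}"])

lemma simple_graph_finite_edges:
  assumes "simple_graph V E"
  shows "finite E"
  using assms unfolding simple_graph_def by (meson Pow_iff finite_Pow_iff finite_subset subsetI)

text \<open>Moving one token changes both the loads and the shares in this way, so this computes the
  change of either term of the potential.\<close>

lemma sum_squares_shift:
  fixes f :: "'b \<Rightarrow> int"
  assumes "finite S" "a \<in> S" "b \<in> S" "a \<noteq> b"
  shows "(\<Sum>i\<in>S. ((f(a := f a - 1, b := f b + 1)) i)\<^sup>2) = (\<Sum>i\<in>S. (f i)\<^sup>2) + 2 * (f b - f a) + 2"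
proof -
  let ?g = "f(a := f a - 1, b := f b + 1)"
  have split: "(\<Sum>i\<in>S. (h i)\<^sup>2) = (h a)\<^sup>2 + ((h b)\<^sup>2 + (\<Sum>i\<in>S - {a} - {b}. (h i)\<^sup>2))"
    for h :: "'b \<Rightarrow> int"
    using assms by (simp add: sum.remove[of S a] sum.remove[of "S - {a}" b])
  have "(\<Sum>i\<in>S - {a} - {b}. (?g i)\<^sup>2) = (\<Sum>i\<in>S - {a} - {b}. (f i)\<^sup>2)"
    by (rule sum.cong) auto
  then show ?thesis
    unfolding split[of f] split[of ?g] using assms(4)
    by (simp add: power2_eq_square algebra_simps)
qed

lemma sum_fun_upd:
  fixes f :: "'b \<Rightarrow> int"
  assumes "finite S"
  shows "(\<Sum>i\<in>S. (f(a := c)) i) = (\<Sum>i\<in>S. f i) + (if a \<in> S then c - f a else 0)"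
proof (cases "a \<in> S")
  case True
  have "(\<Sum>i\<in>S - {a}. (f(a := c)) i) = (\<Sum>i\<in>S - {a}. f i)"
    by (rule sum.cong) auto
  then show ?thesis
    using True assms by (simp add: sum.remove[of S a])
next
  case False
  then have "(\<Sum>i\<in>S. (f(a := c)) i) = (\<Sum>i\<in>S. f i)"
    by (intro sum.cong) auto
  with False show ?thesis by simp
qed

section \<open>Splitting edges between their ends\<close>

text \<open>The sum may run over all of \<open>V\<close> instead of the neighbours of
  \<open>v\<close>, because an \<open>edge_split\<close> vanishes on non-adjacent pairs.\<close>

definition load :: "'a set \<Rightarrow> ('a \<times> 'a \<Rightarrow> int) \<Rightarrow> 'a \<Rightarrow> int" where
  "load V x v = (\<Sum>w\<in>V. x (v, w))"

text \<open>
  \<^term>\<open>x (u, w)\<close> is the part of the edge \<^term>\<open>{u, w}\<close> charged to its end \<^term>\<open>u\<close>.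
\<close>

definition edge_split :: "'a set set \<Rightarrow> int \<Rightarrow> ('a \<times> 'a \<Rightarrow> int) \<Rightarrow> bool" where
  "edge_split E N x \<longleftrightarrow> (\<forall>p. 0 \<le> x p) \<and>
     (\<forall>u w. x (u, w) + x (w, u) = (if {u, w} \<in> E then 2 * N else 0))"

lemma load_shift:
  assumes "finite V" "u \<in> V" "w \<in> V" "u \<noteq> w"
  shows "load V (x((u, w) := x (u, w) - 1, (w, u) := x (w, u) + 1))
    = (load V x)(u := load V x u - 1, w := load V x w + 1)"
proof
  fix v
  let ?y = "x((u, w) := x (u, w) - 1, (w, u) := x (w, u) + 1)"
  consider "v = u" | "v = w" | "v \<noteq> u" "v \<noteq> w" by blast
  then show "load V ?y v = ((load V x)(u := load V x u - 1, w := load V x w + 1)) v"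
  proof cases
    case 1
    have "(\<Sum>b\<in>V. ?y (u, b)) = (\<Sum>b\<in>V. ((\<lambda>b. x (u, b))(w := x (u, w) - 1)) b)"
      using assms(4) by (intro sum.cong) auto
    also have "\<dots> = (\<Sum>b\<in>V. x (u, b)) - 1"
      unfolding sum_fun_upd[OF assms(1)] using assms(2,3) by simp
    finally show ?thesis
      using 1 assms(4) unfolding load_def by simp
  next
    case 2
    have "(\<Sum>b\<in>V. ?y (w, b)) = (\<Sum>b\<in>V. ((\<lambda>b. x (w, b))(u := x (w, u) + 1)) b)"
      using assms(4) by (intro sum.cong) auto
    also have "\<dots> = (\<Sum>b\<in>V. x (w, b)) + 1"
      unfolding sum_fun_upd[OF assms(1)] using assms(2,3) by simp
    finally show ?thesis
      using 2 assms(4) unfolding load_def by simp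
  next
    case 3
    then show ?thesis unfolding load_def by simp
  qed
qed

text \<open>Take a split minimising \<open>\<Phi>\<close>. Moving one token of \<open>{u, w}\<close>
  from \<open>u\<close> to \<open>w\<close> cannot decrease \<open>\<Phi>\<close>; half of this
  inequality is the claim. Positivity of \<open>x (u, w)\<close> keeps the new share
  nonnegative.\<close>

lemma ex_balanced_edge_split:
  fixes K N :: int
  assumes G: "simple_graph V E" and "K \<ge> 0" "N \<ge> 0"
  obtains x where "edge_split E N x"
    "\<And>u w. {u, w} \<in> E \<Longrightarrow> x (u, w) > 0 \<Longrightarrow>
       K * load V x u + x (u, w) \<le> K * load V x w + x (w, u) + K + 1"
proof -
  define \<Phi> where "\<Phi> x = K * (\<Sum>v\<in>V. (load V x v)\<^sup>2) + (\<Sum>p\<in>V \<times> V. (x p)\<^sup>2)" for x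
  have \<Phi>_nonneg: "\<Phi> x \<ge> 0" for x
    using assms(2) unfolding \<Phi>_def by (intro add_nonneg_nonneg mult_nonneg_nonneg sum_nonneg) auto
  have fin: "finite V" using G unfolding simple_graph_def by simp
  \<comment> \<open>The even split shows that there is something to minimise over. Since
    \<open>\<Phi>\<close> takes nonnegative integer values, a minimum is then attained.\<close>
  have "edge_split E N (\<lambda>(u, w). if {u, w} \<in> E then N else 0)"
    using assms(3) unfolding edge_split_def by (auto simp: insert_commute)
  then obtain x where x: "edge_split E N x" and
    min: "\<And>y. edge_split E N y \<Longrightarrow> nat (\<Phi> x) \<le> nat (\<Phi> y)"
    using ex_has_least_nat[of "edge_split E N" _ "\<lambda>x. nat (\<Phi> x)"] by blast
  show thesis
  proof (rule that[OF x])
    fix u w assume e: "{u, w} \<in> E" and pos: "x (u, w) > 0"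
    note uw = simple_graph_edgeD[OF G e]
    let ?y = "x((u, w) := x (u, w) - 1, (w, u) := x (w, u) + 1)"
    have "edge_split E N ?y"
      using x pos uw(3) unfolding edge_split_def by (auto simp: add_nonneg_nonneg)
    then have "nat (\<Phi> x) \<le> nat (\<Phi> ?y)"
      by (rule min)
    then have "\<Phi> x \<le> \<Phi> ?y"
      using \<Phi>_nonneg[of ?y] by linarith
    moreover have "(\<Sum>v\<in>V. (load V ?y v)\<^sup>2)
      = (\<Sum>v\<in>V. (load V x v)\<^sup>2) + 2 * (load V x w - load V x u) + 2"
      unfolding load_shift[OF fin uw] by (rule sum_squares_shift[OF fin uw])
    moreover have "(\<Sum>p\<in>V \<times> V. (?y p)\<^sup>2) = (\<Sum>p\<in>V \<times> V. (x p)\<^sup>2) + 2 * (x (w, u) - x (u, w)) + 2"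
      using fin uw by (intro sum_squares_shift) auto
    ultimately have "0 \<le> K * (2 * (load V x w - load V x u) + 2) + 2 * (x (w, u) - x (u, w)) + 2"
      unfolding \<Phi>_def by (simp only: distrib_left)
    then show "K * load V x u + x (u, w) \<le> K * load V x w + x (w, u) + K + 1"
      by (simp add: algebra_simps)
  qed
qed

text \<open>Double counting: the fibre of an edge under \<open>(a, b) \<mapsto> {a, b}\<close> has
  exactly two elements because its ends differ.\<close>

lemma card_adjacent_pairs:
  assumes G: "simple_graph V E" and "finite X"
  shows "card {p \<in> X \<times> X. {fst p, snd p} \<in> E} = 2 * card (induced_edges E X)"
proof -
  let ?S = "{p \<in> X \<times> X. {fst p, snd p} \<in> E}"
  let ?f = "\<lambda>p::'a \<times> 'a. {fst p, snd p}"
  have fin: "finite (induced_edges E X)"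
    using simple_graph_finite_edges[OF G] unfolding induced_edges_def by simp
  have fib: "card {p \<in> ?S. ?f p = e} = 2" if e: "e \<in> induced_edges E X" for e
  proof -
    have "card e = 2" "e \<in> E" "e \<subseteq> X"
      using e G unfolding induced_edges_def simple_graph_def by auto
    then obtain a b where ab: "e = {a, b}" "a \<noteq> b"
      by (auto simp: card_2_iff)
    then have "{p \<in> ?S. ?f p = e} = {(a, b), (b, a)}"
      using \<open>e \<in> E\<close> \<open>e \<subseteq> X\<close> by (auto simp: doubleton_eq_iff insert_commute)
    then show ?thesis using ab(2) by simp
  qed
  have "card ?S = (\<Sum>e\<in>induced_edges E X. card {p \<in> ?S. ?f p = e})"
  proof -
    have "card ?S = card (\<Union>e\<in>induced_edges E X. {p \<in> ?S. ?f p = e})"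
      by (rule arg_cong[of _ _ card]) (auto simp: induced_edges_def)
    also have "\<dots> = (\<Sum>e\<in>induced_edges E X. card {p \<in> ?S. ?f p = e})"
      using fin assms(2) by (intro card_UN_disjoint) auto
    finally show ?thesis .
  qed
  then show ?thesis using fib by simp
qed

text \<open>Adding the transposed sum turns each term into \<open>2 * N\<close> on adjacent pairs
  and 0 elsewhere, and every edge gives two such pairs.\<close>

lemma edge_split_sum:
  assumes G: "simple_graph V E" and "finite X" and x: "edge_split E N x"
  shows "(\<Sum>u\<in>X. \<Sum>w\<in>X. x (u, w)) = 2 * N * int (card (induced_edges E X))"
proof -
  have "(\<Sum>u\<in>X. \<Sum>w\<in>X. x (u, w)) + (\<Sum>u\<in>X. \<Sum>w\<in>X. x (u, w))
      = (\<Sum>u\<in>X. \<Sum>w\<in>X. x (u, w)) + (\<Sum>u\<in>X. \<Sum>w\<in>X. x (w, u))"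
    by (simp add: sum.swap[of "\<lambda>u w. x (w, u)"])
  also have "\<dots> = (\<Sum>u\<in>X. \<Sum>w\<in>X. if {u, w} \<in> E then 2 * N else 0)"
    using x unfolding edge_split_def by (simp add: sum.distrib[symmetric])
  also have "\<dots> = (\<Sum>p\<in>X \<times> X. if {fst p, snd p} \<in> E then 2 * N else 0)"
    by (simp add: sum.cartesian_product case_prod_beta)
  also have "\<dots> = (\<Sum>p\<in>{p \<in> X \<times> X. {fst p, snd p} \<in> E}. 2 * N)"
    using assms(2) by (intro sum.inter_filter[symmetric]) auto
  also have "\<dots> = 2 * (2 * N * int (card (induced_edges E X)))"
    by (simp add: card_adjacent_pairs[OF G assms(2)])
  finally show ?thesis by simp
qed

section \<open>Upper bound for the loads\<close>

lemma increasing_chain_stabilizes: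
  fixes R :: "nat \<Rightarrow> 'b set"
  assumes "finite V" "\<And>j. R j \<subseteq> V" "\<And>j. R j \<subseteq> R (Suc j)" "R 0 \<noteq> {}"
  shows "\<exists>j\<le>card V. R (Suc j) = R j"
proof (rule ccontr)
  assume "\<not> ?thesis"
  then have ne: "R (Suc j) \<noteq> R j" if "j \<le> card V" for j
    using that by blast
  have fin: "finite (R j)" for j
    using assms(1,2) finite_subset by blast
  have "j \<le> card V \<Longrightarrow> Suc j \<le> card (R j)" for j
  proof (induction j)
    case 0
    then show ?case using assms(4) fin[of 0] by (simp add: Suc_le_eq card_gt_0_iff)
  next
    case (Suc j)
    have "card (R j) < card (R (Suc j))"
      using ne[of j] Suc.prems assms(3)[of j] fin by (intro psubset_card_mono) auto
    then show ?case using Suc by simp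
  qed
  from this[of "card V"] show False
    using card_mono[OF assms(1) assms(2)[of "card V"]] by simp
qed

text \<open>Averaging over a set \<open>R j\<close> of vertices of large load: its total load
  consists of tokens of inner edges only, so \<open>dens\<close> bounds the average by
  \<open>N * \<mu>\<close>, while every load in it is at least that of \<open>v\<close> minus
  \<open>card V * g\<close>.\<close>

lemma load_le:
  fixes \<mu> :: real
  assumes G: "simple_graph V E" and x: "edge_split E N x" and "N \<ge> 0" "g \<ge> 0"
    and step: "\<And>u w. {u, w} \<in> E \<Longrightarrow> x (u, w) > 0 \<Longrightarrow> load V x u \<le> load V x w + g"
    and dens: "\<And>X. X \<subseteq> V \<Longrightarrow> X \<noteq> {} \<Longrightarrow> 2 * real (card (induced_edges E X)) \<le> \<mu> * real (card X)"
    and "v \<in> V"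
  shows "real_of_int (load V x v) \<le> of_int N * \<mu> + real (card V) * of_int g"
proof -
  let ?l = "load V x"
  have fin: "finite V" using G unfolding simple_graph_def by simp
  \<comment> \<open>When the level set stops growing, no edge leaving it is charged to it.\<close>
  define R where "R j = {u \<in> V. ?l u \<ge> ?l v - int j * g}" for j
  have "\<exists>j\<le>card V. R (Suc j) = R j"
  proof (rule increasing_chain_stabilizes[OF fin])
    show "R j \<subseteq> R (Suc j)" for j
      using assms(4) unfolding R_def by (auto simp: algebra_simps)
  qed (use assms(7) in \<open>auto simp: R_def\<close>)
  then obtain j where j: "j \<le> card V" "R (Suc j) = R j" by blast
  have RV: "R j \<subseteq> V" and vR: "v \<in> R j"
    using assms(4,7) unfolding R_def by auto
  then have finR: "finite (R j)" using fin finite_subset by blast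
  have zero: "x (u, w) = 0" if "u \<in> R j" "w \<in> V - R j" for u w
  proof (rule ccontr)
    assume "x (u, w) \<noteq> 0"
    moreover have "x (u, w) \<ge> 0" "x (w, u) \<ge> 0"
      "x (u, w) + x (w, u) = (if {u, w} \<in> E then 2 * N else 0)"
      using x unfolding edge_split_def by auto
    ultimately have "{u, w} \<in> E" "x (u, w) > 0"
      by (auto split: if_splits)
    then have "?l u \<le> ?l w + g" by (rule step)
    then have "w \<in> R (Suc j)"
      using that unfolding R_def by (auto simp: algebra_simps)
    then show False using that j(2) by simp
  qed
  have "(\<Sum>u\<in>R j. ?l u) = (\<Sum>u\<in>R j. \<Sum>w\<in>R j. x (u, w))"
    unfolding load_def using zero fin RV by (intro sum.cong sum.mono_neutral_right) auto
  then have sum: "(\<Sum>u\<in>R j. ?l u) = 2 * N * int (card (induced_edges E (R j)))"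
    using edge_split_sum[OF G finR x] by simp
  have "int (card (R j)) * (?l v - int j * g) \<le> (\<Sum>u\<in>R j. ?l u)"
    by (rule sum_bounded_below) (auto simp: R_def)
  then have "real (card (R j)) * (of_int (?l v) - real j * of_int g)
      \<le> of_int N * (2 * real (card (induced_edges E (R j))))"
    unfolding sum by (simp flip: of_int_le_iff[where 'a = real] add: algebra_simps)
  also have "\<dots> \<le> of_int N * (\<mu> * real (card (R j)))"
    using dens[OF RV] vR assms(3) by (intro mult_left_mono) auto
  also have "\<dots> = real (card (R j)) * (of_int N * \<mu>)"
    by simp
  finally have "of_int (?l v) - real j * of_int g \<le> of_int N * \<mu>"
    using vR finR by (auto simp: mult_le_cancel_left card_gt_0_iff)
  moreover have "real j * of_int g \<le> real (card V) * of_int g"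
    using j(1) assms(4) by (intro mult_right_mono) auto
  ultimately show ?thesis by linarith
qed

section \<open>The independent set and the drop in density\<close>

text \<open>A vertex \<open>u\<close> of maximal \<open>l\<close> dominates all its neighbours;
  discard these and recurse on the rest \<open>W\<close>. Loops are excluded because
  \<open>independent_set\<close> also tests \<open>{x, x}\<close>.\<close>

lemma ex_independent_dominating_upwards:
  fixes l :: "'a \<Rightarrow> int"
  assumes "finite V" "\<And>v. {v} \<notin> E"
  shows "\<exists>I\<subseteq>V. independent_set E I \<and> (\<forall>v\<in>V - I. \<exists>z\<in>I. {v, z} \<in> E \<and> l v \<le> l z)"
  using assms(1)
proof (induction V rule: finite_psubset_induct)
  case (psubset V)
  show ?case
  proof (cases "V = {}")
    case True
    then show ?thesis by (auto simp: independent_set_def)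
  next
    case False
    obtain u where u: "u \<in> V" "\<And>v. v \<in> V \<Longrightarrow> l v \<le> l u"
      using Max_in[of "l ` V"] Max_ge[of "l ` V"] False psubset.hyps by fastforce
    define W where "W = {v \<in> V. v \<noteq> u \<and> {u, v} \<notin> E}"
    have "W \<subset> V" using u(1) unfolding W_def by auto
    from psubset.IH[OF this] obtain I where I: "I \<subseteq> W" "independent_set E I"
      "\<And>v. v \<in> W - I \<Longrightarrow> \<exists>z\<in>I. {v, z} \<in> E \<and> l v \<le> l z" by blast
    have "independent_set E (insert u I)"
      using I(1,2) assms(2) unfolding independent_set_def W_def
      by (auto simp: insert_commute)
    moreover have "\<exists>z\<in>insert u I. {v, z} \<in> E \<and> l v \<le> l z" if "v \<in> V - insert u I" for v
    proof (cases "v \<in> W")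
      case True
      then show ?thesis using I(3)[of v] that by auto
    next
      case False
      then show ?thesis using that u(2)[of v] unfolding W_def by (auto simp: insert_commute)
    qed
    ultimately show ?thesis
      using I(1) u(1) unfolding W_def by (intro exI[of _ "insert u I"]) auto
  qed
qed

lemma ex_independent_set_lowering_density:
  fixes \<mu> \<delta> :: real
  assumes G: "simple_graph V E" and "V \<noteq> {}" "\<delta> > 0"
    and dens: "\<And>X. X \<subseteq> V \<Longrightarrow> X \<noteq> {} \<Longrightarrow> 2 * real (card (induced_edges E X)) \<le> \<mu> * real (card X)"
  obtains I where "I \<subseteq> V" "independent_set E I"
    "\<And>P. P \<subseteq> V - I \<Longrightarrow> 2 * real (card (induced_edges E P)) \<le> (\<mu> - 1 + \<delta>) * real (card P)"
proof -
  have fin: "finite V" using G unfolding simple_graph_def by simp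
  \<comment> \<open>Two errors arise: \<open>K\<close> from \<open>owned\<close>, and
    \<open>n * (1 + 2 * m) \<le> 3 * n * m = K\<close> from the load bound. Together they are at
    most \<open>\<delta> * N\<close>, since \<open>N = K * m\<close> and
    \<open>\<delta> * m \<ge> 2\<close>.\<close>
  obtain m' :: nat where m': "2 / \<delta> < real m'" using reals_Archimedean2 by blast
  define m where "m = int m'"
  have m: "m > 0" "2 \<le> \<delta> * of_int m"
    using m' assms(3) unfolding m_def
    by (auto simp: field_simps intro!: gr0I)
  define n where "n = int (card V)"
  have n: "n > 0" using fin assms(2) unfolding n_def by (simp add: card_gt_0_iff)
  define K where "K = 3 * n * m"
  define N where "N = K * m"
  have K: "K > 0" and N: "N > 0" using m n unfolding K_def N_def by auto
  obtain x where x: "edge_split E N x" and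
    opt: "\<And>u w. {u, w} \<in> E \<Longrightarrow> x (u, w) > 0 \<Longrightarrow>
       K * load V x u + x (u, w) \<le> K * load V x w + x (w, u) + K + 1"
    using ex_balanced_edge_split[OF G, of K N] K N by auto
  have xsum: "x (u, w) + x (w, u) = 2 * N" if "{u, w} \<in> E" for u w
    using x that unfolding edge_split_def by auto
  have xnonneg: "x p \<ge> 0" for p
    using x unfolding edge_split_def by blast
  \<comment> \<open>Here \<open>x (w, u) - x (u, w) \<le> 2 * N - 2\<close> and
    \<open>N = K * m\<close>; dividing the optimality condition by \<open>K\<close> leaves the gap
    \<open>1 + 2 * m\<close>.\<close>
  have step: "load V x u \<le> load V x w + (1 + 2 * m)" if "{u, w} \<in> E" "x (u, w) > 0" for u w
  proof -
    have "K * load V x u \<le> K * (load V x w + (1 + 2 * m))"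
      using opt[OF that] xsum[OF that(1)] that(2) unfolding N_def by (simp add: algebra_simps)
    then show ?thesis using K by simp
  qed
  have load: "real_of_int (load V x v) \<le> of_int N * \<mu> + of_int n * of_int (1 + 2 * m)" if "v \<in> V" for v
    using load_le[OF G x _ _ step dens that] N m unfolding n_def by simp
  \<comment> \<open>Otherwise \<open>x (z, v)\<close> exceeds \<open>x (v, z)\<close> by more than
    \<open>2 * K\<close>, and optimality for the pair \<open>(z, v)\<close> forces a strictly
    smaller load at \<open>z\<close>.\<close>
  have owned: "x (v, z) \<ge> N - K" if "{v, z} \<in> E" "load V x v \<le> load V x z" for v z
  proof (rule ccontr)
    assume "\<not> ?thesis"
    then have a: "x (v, z) + K < N" by simp
    have e: "{z, v} \<in> E" using that(1) by (simp add: insert_commute)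
    have "x (z, v) > 0" using a xsum[OF that(1)] K N xnonneg[of "(v, z)"] by linarith
    from opt[OF e this] have "K * load V x z + K \<le> K * load V x v"
      using a xsum[OF that(1)] by linarith
    moreover have "K * load V x v \<le> K * load V x z" using that(2) K by simp
    ultimately show False using K by linarith
  qed
  have "{v} \<notin> E" for v
    using G unfolding simple_graph_def by (auto dest!: bspec[of _ _ "{v}"])
  from ex_independent_dominating_upwards[OF fin this, of "load V x"]
  obtain I where I: "I \<subseteq> V" "independent_set E I"
    "\<And>v. v \<in> V - I \<Longrightarrow> \<exists>z\<in>I. {v, z} \<in> E \<and> load V x v \<le> load V x z" by blast
  show thesis
  proof (rule that[OF I(1,2)])
    fix P assume P: "P \<subseteq> V - I"
    then have finP: "finite P" using fin finite_subset by blast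
    have bound: "real_of_int (\<Sum>w\<in>P. x (v, w)) \<le> of_int N * (\<mu> - 1 + \<delta>)" if v: "v \<in> P" for v
    proof -
      obtain z where z: "z \<in> I" "{v, z} \<in> E" "load V x v \<le> load V x z"
        using I(3) v P by blast
      have "(\<Sum>w\<in>P. x (v, w)) + x (v, z) = (\<Sum>w\<in>insert z P. x (v, w))"
        using z(1) P finP by (subst sum.insert) auto
      also have "\<dots> \<le> load V x v"
        unfolding load_def using z(1) P I(1) fin xnonneg by (intro sum_mono2) auto
      finally have "(\<Sum>w\<in>P. x (v, w)) \<le> load V x v - (N - K)"
        using owned[OF z(2,3)] by linarith
      then have "real_of_int (\<Sum>w\<in>P. x (v, w)) \<le> of_int (load V x v) - (of_int N - of_int K)"
        by (simp only: of_int_le_iff flip: of_int_diff)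
      also have "\<dots> \<le> of_int N * \<mu> + of_int n * of_int (1 + 2 * m) - (of_int N - of_int K)"
        using load[of v] v P by auto
      also have "\<dots> \<le> of_int N * \<mu> + of_int (2 * K) - of_int N"
      proof -
        have "n \<le> n * m" using m n by simp
        then have "n * (1 + 2 * m) \<le> K" unfolding K_def by (simp add: algebra_simps)
        then have "real_of_int n * of_int (1 + 2 * m) \<le> of_int K"
          by (metis of_int_le_iff of_int_mult)
        then show ?thesis by simp
      qed
      also have "\<dots> \<le> of_int N * (\<mu> - 1 + \<delta>)"
      proof -
        have "real_of_int K * 2 \<le> of_int K * (\<delta> * of_int m)"
          using m(2) K by (intro mult_left_mono) auto
        then show ?thesis unfolding N_def by (simp add: algebra_simps)
      qed
      finally show ?thesis .
    qed
    have "of_int N * (2 * real (card (induced_edges E P))) = real_of_int (\<Sum>u\<in>P. \<Sum>w\<in>P. x (u, w))"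
      unfolding edge_split_sum[OF G finP x] by simp
    also have "\<dots> = (\<Sum>u\<in>P. real_of_int (\<Sum>w\<in>P. x (u, w)))"
      by simp
    also have "\<dots> \<le> real (card P) * (of_int N * (\<mu> - 1 + \<delta>))"
      using bound by (rule sum_bounded_above)
    also have "\<dots> = of_int N * ((\<mu> - 1 + \<delta>) * real (card P))"
      by simp
    finally show "2 * real (card (induced_edges E P)) \<le> (\<mu> - 1 + \<delta>) * real (card P)"
      using N by simp
  qed
qed

section \<open>Edge counts of paths, cycles and components\<close>

text \<open>The counting step for sets built up vertex by vertex: the edges from \<open>v\<close> to
  \<open>N\<close> are new because \<open>v\<close> is not in \<open>X\<close>.\<close>

lemma card_induced_edges_insert:
  assumes E: "finite E" and "finite X" "v \<notin> X" "N \<subseteq> X" "\<And>u. u \<in> N \<Longrightarrow> {u, v} \<in> E"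
  shows "card (induced_edges E X) + card N \<le> card (induced_edges E (insert v X))"
proof -
  let ?S = "(\<lambda>u. {u, v}) ` N"
  have "card ?S = card N"
    using assms(3,4) by (intro card_image inj_onI) (auto simp: doubleton_eq_iff)
  moreover have "induced_edges E X \<inter> ?S = {}"
    using assms(3) unfolding induced_edges_def by auto
  moreover have "finite (induced_edges E X)" "finite (induced_edges E (insert v X))"
    using E unfolding induced_edges_def by auto
  moreover have "finite N" using assms finite_subset by blast
  ultimately have "card (induced_edges E X) + card N = card (induced_edges E X \<union> ?S)"
    by (simp add: card_Un_disjoint)
  also have "\<dots> \<le> card (induced_edges E (insert v X))"
    using assms E by (intro card_mono) (auto simp: induced_edges_def)
  finally show ?thesis .
qed

lemma card_induced_edges_path:
  assumes "finite E" "distinct c" "\<And>i. Suc i < length c \<Longrightarrow> {c ! i, c ! Suc i} \<in> E"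
  shows "length c \<le> card (induced_edges E (set c)) + 1"
  using assms(2,3)
proof (induction c rule: rev_induct)
  case Nil
  then show ?case by simp
next
  case (snoc v c)
  show ?case
  proof (cases "c = []")
    case True
    then show ?thesis by simp
  next
    case False
    have "{c ! i, c ! Suc i} \<in> E" if "Suc i < length c" for i
      using snoc.prems(2)[of i] that by (simp add: nth_append)
    then have "length c \<le> card (induced_edges E (set c)) + 1"
      using snoc by simp
    moreover have "{last c, v} \<in> E"
      using snoc.prems(2)[of "length c - 1"] False by (simp add: nth_append last_conv_nth)
    then have "card (induced_edges E (set c)) + card {last c} \<le> card (induced_edges E (insert v (set c)))"
      using False snoc.prems(1) assms(1) by (intro card_induced_edges_insert) auto
    ultimately show ?thesis by simp
  qed
qed

text \<open>Removing the last vertex \<open>v\<close> leaves a path \<open>b\<close>. Its two ends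
  are distinct, as \<open>length b \<ge> 2\<close>, and both are adjacent to \<open>v\<close>, which
  yields one edge more than for a path.\<close>

lemma card_induced_edges_cycle:
  assumes "finite E" and c: "is_cycle V E c"
  shows "length c \<le> card (induced_edges E (set c))"
proof -
  have len: "length c \<ge> 3" and dist: "distinct c"
    and path: "\<And>i. Suc i < length c \<Longrightarrow> {c ! i, c ! Suc i} \<in> E"
    and close: "{last c, hd c} \<in> E"
    using c unfolding is_cycle_def adj_def by auto
  obtain b v where bv: "c = b @ [v]" using len by (cases c rule: rev_cases) auto
  have b: "b \<noteq> []" "length b \<ge> 2" using len bv by auto
  have "{b ! i, b ! Suc i} \<in> E" if "Suc i < length b" for i
    using path[of i] that bv by (simp add: nth_append)
  then have "length b \<le> card (induced_edges E (set b)) + 1"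
    using dist bv assms(1) by (intro card_induced_edges_path) auto
  moreover have "{last b, v} \<in> E"
    using path[of "length b - 1"] b bv by (simp add: nth_append last_conv_nth)
  then have "card (induced_edges E (set b)) + card {hd b, last b} \<le> card (induced_edges E (insert v (set b)))"
    using b close bv dist assms(1)
    by (intro card_induced_edges_insert) (auto simp: insert_commute)
  moreover have "hd b \<noteq> last b"
    using b dist bv by (cases b) (auto split: if_splits)
  ultimately show ?thesis using bv by simp
qed

lemma card_component_le:
  assumes "finite B" "finite E" "x \<in> B"
  shows "component B E x \<subseteq> B"
    "card (component B E x) \<le> card (induced_edges E (component B E x)) + 1"
proof -
  let ?step = "\<lambda>u v. u \<in> B \<and> v \<in> B \<and> adj E u v"
  let ?C = "component B E x"
  show sub: "?C \<subseteq> B"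
  proof
    fix y assume "y \<in> ?C"
    then have "?step\<^sup>*\<^sup>* x y" unfolding component_def by simp
    then show "y \<in> B" by (cases rule: rtranclp.cases) (use assms(3) in auto)
  qed
  then have fin: "finite ?C" using assms(1) finite_subset by blast
  \<comment> \<open>Grow \<open>P\<close> from \<open>{x}\<close> one vertex at a time, gaining an
    edge each time. Keeping \<open>x\<close> in \<open>P\<close> guarantees a step leaving
    \<open>P\<close> as long as \<open>P\<close> is not the whole component.\<close>
  have "\<exists>P\<subseteq>?C. x \<in> P \<and> card P = Suc k \<and> Suc k \<le> card (induced_edges E P) + 1"
    if "Suc k \<le> card ?C" for k
    using that
  proof (induction k)
    case 0
    then show ?case by (intro exI[of _ "{x}"]) (auto simp: component_def)
  next
    case (Suc k)
    then obtain P where P: "P \<subseteq> ?C" "x \<in> P" "card P = Suc k" "Suc k \<le> card (induced_edges E P) + 1"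
      by auto
    have "\<exists>u\<in>P. \<exists>v. v \<notin> P \<and> ?step u v"
    proof (rule ccontr)
      assume no: "\<not> ?thesis"
      have "y \<in> P" if "?step\<^sup>*\<^sup>* x y" for y
        using that by (induction rule: rtranclp_induct) (use P(2) no in auto)
      then have "?C \<subseteq> P" unfolding component_def by auto
      then show False using P Suc.prems by auto
    qed
    then obtain u v where uv: "u \<in> P" "v \<notin> P" "?step u v" by blast
    have "?step\<^sup>*\<^sup>* x v"
      using P(1) uv unfolding component_def by (auto intro: rtranclp.rtrancl_into_rtrancl)
    then have vC: "v \<in> ?C" unfolding component_def by simp
    have finP: "finite P" using P(1) fin finite_subset by blast
    have "card (induced_edges E P) + card {u} \<le> card (induced_edges E (insert v P))"
      using uv finP assms(2) by (intro card_induced_edges_insert) (auto simp: adj_def)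
    then show ?case
      using P uv vC finP by (intro exI[of _ "insert v P"]) auto
  qed
  note grow = this
  have "x \<in> ?C" unfolding component_def by simp
  then obtain k where k: "card ?C = Suc k" using fin by (cases "card ?C") auto
  from grow[of k] k obtain P where "P \<subseteq> ?C" "card P = Suc k" "Suc k \<le> card (induced_edges E P) + 1"
    by auto
  then show "card ?C \<le> card (induced_edges E ?C) + 1"
    using card_subset_eq[OF fin, of P] k by auto
qed

section \<open>From the maximum average degree to the partition\<close>

text \<open>The induced subgraph on \<open>X\<close> competes in the maximum, which is over a finite
  set since a finite graph has finitely many subgraphs.\<close>

lemma mad_bound:
  assumes G: "simple_graph V E" and "X \<subseteq> V" "X \<noteq> {}"
  shows "2 * real (card (induced_edges E X)) \<le> mad V E * real (card X)"
proof -
  let ?S = "{2 * real (card E') / real (card V') | V' E'. subgraph V' E' V E \<and> V' \<noteq> {}}"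
  have fin: "finite V" "finite E"
    using G simple_graph_finite_edges[OF G] unfolding simple_graph_def by auto
  have "?S \<subseteq> (\<lambda>(V', E'). 2 * real (card E') / real (card V')) ` (Pow V \<times> Pow E)"
    unfolding subgraph_def by auto
  then have "finite ?S" using fin by (meson finite_Pow_iff finite_SigmaI finite_imageI finite_subset)
  moreover have "subgraph X (induced_edges E X) V E"
    using assms(2) unfolding subgraph_def induced_edges_def by auto
  then have "2 * real (card (induced_edges E X)) / real (card X) \<in> ?S"
    using assms(3) by blast
  ultimately have "2 * real (card (induced_edges E X)) / real (card X) \<le> mad V E"
    unfolding mad_def by (rule Max_ge)
  moreover have "card X > 0" using assms fin(1) by (metis card_gt_0_iff finite_subset)
  ultimately show ?thesis by (simp add: field_simps)
qed

theorem theorem9: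
  fixes V :: "'a set" and E :: "'a set set" and M :: real and d :: nat
  assumes "simple_graph V E"
    and "M < 3"
    and "d > 0"
    and "mad V E < M"
    and "real d > 2 / (3 - M) - 2"
  shows "\<exists>A B. A \<union> B = V \<and> A \<inter> B = {} \<and> independent_set E A \<and>
           forest B (induced_edges E B) \<and>
           (\<forall>x\<in>B. card (component B (induced_edges E B) x) \<le> d + 1)"
proof (cases "V = {}")
  \<comment> \<open>Here \<open>mad\<close> is a \<open>Max\<close> over the empty set, so this case
    is settled directly.\<close>
  case True
  then show ?thesis
    by (auto simp: independent_set_def forest_def is_cycle_def)
next
  case False
  \<comment> \<open>The gap \<open>\<delta> = M - mad V E\<close> is positive and turns
    \<open>mad V E - 1 + \<delta>\<close> into \<open>M - 1\<close>.\<close>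
  obtain A where A: "A \<subseteq> V" "independent_set E A" and
    dens: "\<And>P. P \<subseteq> V - A \<Longrightarrow> 2 * real (card (induced_edges E P)) \<le> (M - 1) * real (card P)"
    using ex_independent_set_lowering_density[OF assms(1) False, of "M - mad V E" "mad V E"]
      mad_bound[OF assms(1)] assms(4) by auto
  define B where "B = V - A"
  let ?F = "induced_edges E B"
  have fin: "finite B" "finite ?F"
    using assms(1) simple_graph_finite_edges[OF assms(1)]
    unfolding simple_graph_def B_def induced_edges_def by auto
  \<comment> \<open>The hypothesis on \<open>d\<close> says \<open>(d + 2) * (3 - M) > 2\<close>,
    that is, \<open>M - 1 < 2 - 2 / (d + 2)\<close>; clearing denominators gives an inequality of
    naturals.\<close>
  have sparse: "(d + 2) * card (induced_edges ?F P) < (d + 1) * card P" if P: "P \<subseteq> B" "P \<noteq> {}" for P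
  proof -
    have "induced_edges ?F P = induced_edges E P"
      using P(1) unfolding induced_edges_def by auto
    then have "2 * real (card (induced_edges ?F P)) \<le> (M - 1) * real (card P)"
      using dens P(1) unfolding B_def by simp
    moreover have "(real d + 2) * (M - 1) < 2 * (real d + 1)"
      using assms(2,5) by (simp add: field_simps)
    moreover have "card P > 0" using P fin(1) by (metis card_gt_0_iff finite_subset)
    ultimately have "(real d + 2) * (2 * real (card (induced_edges ?F P)))
        \<le> (real d + 2) * (M - 1) * real (card P)"
      "(real d + 2) * (M - 1) * real (card P) < 2 * (real d + 1) * real (card P)"
      by (simp_all add: mult.assoc)
    then have "real ((d + 2) * card (induced_edges ?F P)) < real ((d + 1) * card P)"
      by (simp add: algebra_simps)
    then show ?thesis by (simp only: of_nat_less_iff)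
  qed
  have "forest B ?F"
    unfolding forest_def
  proof
    assume "\<exists>c. is_cycle B ?F c"
    then obtain c where c: "is_cycle B ?F c" by blast
    then have "set c \<subseteq> B" "set c \<noteq> {}" "card (set c) = length c"
      unfolding is_cycle_def by (auto simp: distinct_card)
    \<comment> \<open>A cycle has at least as many induced edges as vertices, against
      \<open>sparse\<close>.\<close>
    then have "(d + 2) * card (induced_edges ?F (set c)) < (d + 1) * length c"
      using sparse[of "set c"] by simp
    moreover have "(d + 2) * length c \<le> (d + 2) * card (induced_edges ?F (set c))"
      using card_induced_edges_cycle[OF fin(2) c] by (intro mult_left_mono) auto
    ultimately show False by (simp add: algebra_simps)
  qed
  moreover have "card (component B ?F x) \<le> d + 1" if x: "x \<in> B" for x
  proof -
    let ?C = "component B ?F x"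
    note C = card_component_le[OF fin x]
    have "x \<in> ?C" unfolding component_def by simp
    \<comment> \<open>With at least \<open>card ?C - 1\<close> edges, \<open>sparse\<close> gives
      \<open>(d + 2) * (card ?C - 1) < (d + 1) * card ?C\<close>, hence
      \<open>card ?C < d + 2\<close>.\<close>
    then have "(d + 2) * card (induced_edges ?F ?C) < (d + 1) * card ?C"
      using sparse[OF C(1)] by auto
    moreover have "(d + 2) * card ?C \<le> (d + 2) * (card (induced_edges ?F ?C) + 1)"
      using C(2) by (rule mult_left_mono) simp
    ultimately show ?thesis by (simp add: algebra_simps)
  qed
  ultimately show ?thesis
    using A unfolding B_def by (intro exI[of _ A] exI[of _ "V - A"]) auto
qed

end
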